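(* There is a universal constant $c>0$ such that the following holds. Let $d,b\ge3$ be integers, let $\{1,\dots,db\}$ be partitioned into $d$ groups of equal size $b_1=\dots=b_d=b$, let $s,s_g$ be positive integers with $s_g\le d$ and $s_g\le s\le s_gb$, and let $X\in\mathbb{R}^{n\times(db)}$. Suppose that for some $(\lambda,\lambda_g)$ with $\lambda,\lambda_g\ge0$ and $\lambda+\lambda_g>0$, every $(2s,2s_g)$-sparse vector $\beta\in\mathbb{R}^{db}$ is a minimizer of $$\min_z\ \lambda\|z\|_1+\lambda_g\|z\|_{1,2}\quad\text{subject to}\quad Xz=X\beta .$$ Then $$n\ge c\left(s_g\log(d/s_g)+s\log(es_gb/s)\right).$$
   Context: For $z\in\mathbb{R}^{db}$ with groups $(1),\dots,(d)$, $z_{(j)}$ is the subvector on group $j$, $\|z\|_0$ is the number of nonzero entries, $\|z\|_{0,2}=\sum_{j=1}^d1_{\{z_{(j)}\ne0\}}$, $\|z\|_1=\sum_i|z_i|$, $\|z\|_{1,2}=\sum_{j=1}^d\|z_{(j)}\|_2$. A vector $\beta$ is $(2s,2s_g)$-sparse if $\|\beta\|_0\le2s$ and $\|\beta\|_{0,2}\le2s_g$. *)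

theory Defs
  imports Complex_Main "HOL-Analysis.L2_Norm" "HOL-Library.Disjoint_Sets" "Jordan_Normal_Form.Matrix"
begin

text \<open>
  Vectors in \<open>\<real>\<^sup>N\<close> are elements of \<^term>\<open>carrier_vec N\<close>, so coordinates are indexed by
  \<open>0, \<dots>, N - 1\<close>; the \<open>d\<close> groups are index sets \<open>G 0, \<dots>, G (d - 1)\<close>.
\<close>

definition equal_groups :: "nat \<Rightarrow> nat \<Rightarrow> (nat \<Rightarrow> nat set) \<Rightarrow> bool" where
  "equal_groups d b G \<longleftrightarrow>
     disjoint_family_on G {..<d} \<and> (\<Union>j<d. G j) = {..<d * b} \<and> (\<forall>j<d. card (G j) = b)"

definition l0 :: "real vec \<Rightarrow> nat" where
  "l0 z = card {i. i < dim_vec z \<and> z $ i \<noteq> 0}"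

definition l02 :: "nat \<Rightarrow> (nat \<Rightarrow> nat set) \<Rightarrow> real vec \<Rightarrow> nat" where
  "l02 d G z = card {j. j < d \<and> (\<exists>i\<in>G j. z $ i \<noteq> 0)}"

definition l1_norm :: "real vec \<Rightarrow> real" where
  "l1_norm z = (\<Sum>i<dim_vec z. \<bar>z $ i\<bar>)"

definition l12_norm :: "nat \<Rightarrow> (nat \<Rightarrow> nat set) \<Rightarrow> real vec \<Rightarrow> real" where
  "l12_norm d G z = (\<Sum>j<d. L2_set (\<lambda>i. z $ i) (G j))"

definition doubly_sparse :: "nat \<Rightarrow> (nat \<Rightarrow> nat set) \<Rightarrow> nat \<Rightarrow> nat \<Rightarrow> real vec \<Rightarrow> bool" where
  "doubly_sparse d G k kg z \<longleftrightarrow> l0 z \<le> k \<and> l02 d G z \<le> kg"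

end

theory Submission imports Defs begin

text \<open>
  For sparse vectors the objective coincides with the quotient norm on the image of \<open>X\<close>. Hence
  indicator vectors of supports that are far apart have images that are far apart in an
  \<open>n\<close>-dimensional normed space, and there are at most exponentially many of them in \<open>n\<close>. Supports
  are read off from codes of large Hamming distance (Gilbert--Varshamov) in two ways: one coordinate
  in each of \<open>sg\<close> groups gives \<open>sg * ln (d / sg)\<close>, and \<open>s div sg\<close> coordinates in each of the first
  \<open>sg\<close> groups give \<open>s * ln (sg * b / s)\<close>. Linear terms are absorbed by \<open>s \<le> 4 * n\<close>, which is the same
  packing argument for the cube \<open>{0,1}\<^sup>s\<close> with the maximum norm.
\<close>

section \<open>Linear maps on functions and bounded preimages\<close>

text \<open>Vectors are total functions of which only the entries below \<open>p\<close> are read,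
  so sums and multiples need no dimension conditions.\<close>

definition mat_app :: "nat \<Rightarrow> (nat \<Rightarrow> nat \<Rightarrow> real) \<Rightarrow> (nat \<Rightarrow> real) \<Rightarrow> nat \<Rightarrow> real" where
  "mat_app p a u i = (\<Sum>k<p. a i k * u k)"

lemma mat_app_add: "mat_app p a (\<lambda>k. u k + v k) i = mat_app p a u i + mat_app p a v i"
  by (simp add: mat_app_def sum.distrib distrib_left)

lemma mat_app_diff: "mat_app p a (\<lambda>k. u k - v k) i = mat_app p a u i - mat_app p a v i"
  by (simp add: mat_app_def sum_subtractf right_diff_distrib)

lemma mat_app_scale: "mat_app p a (\<lambda>k. c * u k) i = c * mat_app p a u i"
  by (simp add: mat_app_def sum_distrib_left mult_ac)

lemma abs_mat_app_le: "\<bar>mat_app p a u i\<bar> \<le> (\<Sum>k<p. \<bar>a i k\<bar>) * (\<Sum>k<p. \<bar>u k\<bar>)"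
proof -
  have "\<bar>mat_app p a u i\<bar> \<le> (\<Sum>k<p. \<bar>a i k\<bar> * \<bar>u k\<bar>)"
    unfolding mat_app_def by (rule order_trans[OF sum_abs]) (simp add: abs_mult)
  also have "\<dots> \<le> (\<Sum>k<p. \<bar>a i k\<bar> * (\<Sum>k<p. \<bar>u k\<bar>))"
    by (intro sum_mono mult_left_mono member_le_sum) auto
  finally show ?thesis by (simp add: sum_distrib_right)
qed

text \<open>An open mapping property by hand: it turns a small image into a preimage with small
  entries. The induction adds one row at a time. If the new row vanishes on the common kernel of the
  earlier ones, the old preimage already fits; otherwise a kernel vector on which it is nonzero
  corrects the last coordinate.\<close>

lemma bounded_lift:
  "\<exists>C\<ge>0. \<forall>u. \<exists>v. (\<forall>i<n. mat_app p a v i = mat_app p a u i) \<and>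
     (\<Sum>k<p. \<bar>v k\<bar>) \<le> C * (\<Sum>i<n. \<bar>mat_app p a u i\<bar>)"
proof (induction n)
  case 0
  show ?case by (intro exI[of _ 0]) (auto intro: exI[of _ "\<lambda>_. 0"])
next
  case (Suc n)
  let ?f = "mat_app p a" and ?l = "\<lambda>u. \<Sum>k<p. \<bar>u k\<bar>"
  obtain C where C: "C \<ge> 0" and
    IH: "\<And>u. \<exists>v. (\<forall>i<n. ?f v i = ?f u i) \<and> ?l v \<le> C * (\<Sum>i<n. \<bar>?f u i\<bar>)"
    using Suc.IH by blast
  show ?case
  proof (cases "\<forall>v. (\<forall>i<n. ?f v i = 0) \<longrightarrow> ?f v n = 0")
    case True
    have "\<exists>v. (\<forall>i<Suc n. ?f v i = ?f u i) \<and> ?l v \<le> C * (\<Sum>i<Suc n. \<bar>?f u i\<bar>)" for u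
    proof -
      obtain v where v: "\<forall>i<n. ?f v i = ?f u i" "?l v \<le> C * (\<Sum>i<n. \<bar>?f u i\<bar>)"
        using IH by blast
      have "?f (\<lambda>k. u k - v k) n = 0"
        using True[rule_format, of "\<lambda>k. u k - v k"] v(1) by (simp add: mat_app_diff)
      then have "\<forall>i<Suc n. ?f v i = ?f u i" using v(1) by (simp add: mat_app_diff less_Suc_eq)
      moreover have "C * (\<Sum>i<n. \<bar>?f u i\<bar>) \<le> C * (\<Sum>i<Suc n. \<bar>?f u i\<bar>)"
        using C by (intro mult_left_mono) auto
      ultimately show ?thesis using v(2) by (intro exI[of _ v]) auto
    qed
    then show ?thesis using C by blast
  next
    case False
    then obtain e where e: "\<forall>i<n. ?f e i = 0" "?f e n \<noteq> 0" by blast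
    define B where "B = (\<Sum>k<p. \<bar>a n k\<bar>)"
    define E where "E = ?l e / \<bar>?f e n\<bar>"
    have B: "B \<ge> 0" and E: "E \<ge> 0" unfolding B_def E_def by (auto intro: sum_nonneg)
    \<comment> \<open>\<open>C\<close> pays for \<open>v\<close>. The correction costs
      \<open>E\<close> per unit of error in row \<open>n\<close>, and that error is at most
      \<open>1 + B * C\<close> times the image size.\<close>
    define C' where "C' = C + (1 + B * C) * E"
    have "\<exists>v. (\<forall>i<Suc n. ?f v i = ?f u i) \<and> ?l v \<le> C' * (\<Sum>i<Suc n. \<bar>?f u i\<bar>)" for u
    proof -
      let ?S = "\<Sum>i<Suc n. \<bar>?f u i\<bar>"
      obtain v where v: "\<forall>i<n. ?f v i = ?f u i" "?l v \<le> C * (\<Sum>i<n. \<bar>?f u i\<bar>)"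
        using IH by blast
      have "C * (\<Sum>i<n. \<bar>?f u i\<bar>) \<le> C * ?S"
        using C by (intro mult_left_mono) auto
      with v(2) have lv: "?l v \<le> C * ?S" by linarith
      define r where "r = (?f u n - ?f v n) / ?f e n"
      define w where "w = (\<lambda>k. v k + r * e k)"
      have "r * ?f e n = ?f u n - ?f v n" using e by (simp add: r_def)
      then have "?f w i = ?f u i" if "i < Suc n" for i
        using that v(1) e by (auto simp: w_def mat_app_add mat_app_scale less_Suc_eq)
      moreover have "?l w \<le> C' * ?S"
      proof -
        have "?l w \<le> (\<Sum>k<p. \<bar>v k\<bar> + \<bar>r\<bar> * \<bar>e k\<bar>)"
          unfolding w_def by (intro sum_mono order_trans[OF abs_triangle_ineq]) (simp add: abs_mult)
        then have "?l w \<le> ?l v + \<bar>?f u n - ?f v n\<bar> * E"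
          by (simp add: sum.distrib flip: sum_distrib_left) (simp add: r_def E_def abs_divide)
        moreover have "\<bar>?f u n\<bar> \<le> ?S"
          by (rule member_le_sum[of n "{..<Suc n}" "\<lambda>i. \<bar>?f u i\<bar>"]) auto
        moreover have "\<bar>?f v n\<bar> \<le> B * ?l v" unfolding B_def by (rule abs_mat_app_le)
        moreover have "B * ?l v \<le> B * (C * ?S)" using lv B by (rule mult_left_mono)
        ultimately have "?l w \<le> C * ?S + (?S + B * (C * ?S)) * E"
          using lv mult_right_mono[OF _ E, of "\<bar>?f u n - ?f v n\<bar>" "?S + B * (C * ?S)"]
          by linarith
        then show ?thesis by (simp add: C'_def algebra_simps del: sum.lessThan_Suc)
      qed
      ultimately show ?thesis by blast
    qed
    moreover have "C' \<ge> 0" using C B E by (simp add: C'_def)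
    ultimately show ?thesis by blast
  qed
qed

section \<open>Packing in finite-dimensional quotient seminorms\<close>

text \<open>
  Packing without volumes: sums \<open>x\<^sub>0 + x\<^sub>1 / 16 + x\<^sub>2 / 16^2 + \<dots>\<close> of \<open>L\<close> terms with digits in a
  separated family \<open>A\<close> stay in a bounded set and are separated by a multiple of \<open>1 / 16^L\<close>. Counting grid cells in
  \<open>\<real>\<^sup>n\<close> bounds \<open>card A ^ L\<close> by a constant times \<open>(16^n)^L\<close>, so \<open>card A \<le> 16^n\<close> as \<open>L\<close> grows.
\<close>

fun expansion :: "(nat \<Rightarrow> real) list \<Rightarrow> nat \<Rightarrow> real" where
  "expansion [] = (\<lambda>k. 0)"
| "expansion (x # xs) = (\<lambda>k. x k + 1/16 * expansion xs k)"

text \<open>Points in the same cell of a grid of mesh \<open>\<eta>\<close> differ by less than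
  \<open>\<eta>\<close> in every coordinate, so rounding is injective on \<open>W\<close> and the
  number of cells bounds its size.\<close>

lemma pigeonhole_grid:
  fixes g :: "'a \<Rightarrow> nat \<Rightarrow> real"
  assumes fin: "finite W" and pos: "\<eta> > 0" and bd: "\<And>w i. w \<in> W \<Longrightarrow> i < n \<Longrightarrow> \<bar>g w i\<bar> \<le> D"
    and D: "D \<ge> \<eta>"
    and sep: "\<And>v w. v \<in> W \<Longrightarrow> w \<in> W \<Longrightarrow> v \<noteq> w \<Longrightarrow> \<exists>i<n. \<bar>g v i - g w i\<bar> \<ge> \<eta>"
  shows "real (card W) \<le> (5 * D / \<eta>) ^ n"
proof -
  define K where "K = \<lfloor>D / \<eta>\<rfloor> + 1"
  define h where "h w = restrict (\<lambda>i. \<lfloor>g w i / \<eta>\<rfloor>) {..<n}" for w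
  have inj: "inj_on h W"
  proof (rule inj_onI, rule ccontr)
    fix v w assume vw: "v \<in> W" "w \<in> W" "h v = h w" "v \<noteq> w"
    then obtain i where i: "i < n" "\<bar>g v i - g w i\<bar> \<ge> \<eta>" using sep by blast
    have "\<lfloor>g v i / \<eta>\<rfloor> = \<lfloor>g w i / \<eta>\<rfloor>"
      using fun_cong[OF vw(3), of i] i(1) by (simp add: h_def)
    then have "\<bar>g v i / \<eta> - g w i / \<eta>\<bar> < 1" by linarith
    then have "\<bar>(g v i - g w i) / \<eta>\<bar> < 1" by (simp add: diff_divide_distrib)
    then show False using i(2) pos by (simp add: abs_divide)
  qed
  have "h ` W \<subseteq> PiE {..<n} (\<lambda>_. {-K..K})"
  proof (rule image_subsetI)
    fix w assume w: "w \<in> W"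
    have "-K \<le> \<lfloor>g w i / \<eta>\<rfloor> \<and> \<lfloor>g w i / \<eta>\<rfloor> \<le> K" if "i < n" for i
    proof -
      have "\<bar>g w i / \<eta>\<bar> \<le> D / \<eta>" using bd[OF w that] pos by (simp add: abs_divide divide_right_mono)
      then have "g w i / \<eta> \<le> D / \<eta>" "- (D / \<eta>) \<le> g w i / \<eta>"
        unfolding abs_le_iff by linarith+
      then show ?thesis unfolding K_def by linarith
    qed
    then show "h w \<in> PiE {..<n} (\<lambda>_. {-K..K})" by (auto simp: h_def)
  qed
  then have "card W \<le> card (PiE {..<n} (\<lambda>_. {-K..K}))"
    by (rule card_inj_on_le[OF inj]) (auto intro: finite_PiE)
  also have "\<dots> = nat (2 * K + 1) ^ n" by (simp add: card_PiE)
  finally have "real (card W) \<le> real (nat (2 * K + 1)) ^ n"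
    by (metis of_nat_le_iff of_nat_power)
  also have "\<dots> \<le> (5 * D / \<eta>) ^ n"
  proof (intro power_mono)
    \<comment> \<open>The number of cells per axis is at most \<open>2 * (D / \<eta>) + 3\<close>,
      and the 3 is absorbed because \<open>D / \<eta>\<close> is at least 1.\<close>
    have "1 \<le> D / \<eta>" using D pos by simp
    moreover have "real_of_int K \<le> D / \<eta> + 1" unfolding K_def by linarith
    moreover have "K \<ge> 0" unfolding K_def using calculation(1) by (simp add: le_floor_iff)
    ultimately have "real (nat (2 * K + 1)) \<le> 5 * (D / \<eta>)" by simp
    then show "real (nat (2 * K + 1)) \<le> 5 * D / \<eta>" by simp
  qed simp
  finally show ?thesis .
qed

text \<open>Serves three seminorms: the absolute value of one image coordinate, the objective, and a
  maximum over a set of coordinates. Domination makes vectors with small entries small in the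
  seminorm.\<close>

locale dominated_seminorm =
  fixes p :: nat and \<nu> :: "(nat \<Rightarrow> real) \<Rightarrow> real"
  assumes triangle: "\<nu> (\<lambda>k. u k + v k) \<le> \<nu> u + \<nu> v"
    and scale: "\<nu> (\<lambda>k. c * u k) = \<bar>c\<bar> * \<nu> u"
    and dominated: "\<exists>B. \<forall>u. \<nu> u \<le> B * (\<Sum>k<p. \<bar>u k\<bar>)"
begin

lemma zero: "\<nu> (\<lambda>k. 0) = 0"
  using scale[of 0 "\<lambda>k. 0"] by simp

lemma triangle_diff: "\<nu> (\<lambda>k. u k - v k) \<le> \<nu> u + \<nu> v"
  using triangle[of u "\<lambda>k. - 1 * v k"] scale[of "-1" v] by simp

lemma expansion_le:
  assumes "set xs \<subseteq> A" "\<And>x. x \<in> A \<Longrightarrow> \<nu> x \<le> R" "R \<ge> 0"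
  shows "\<nu> (expansion xs) \<le> 2 * R"
  using assms(1)
proof (induction xs)
  case Nil
  then show ?case using assms(3) by (simp add: zero)
next
  case (Cons x xs)
  have "\<nu> (expansion (x # xs)) \<le> \<nu> x + 1/16 * \<nu> (expansion xs)"
    using triangle[of x "\<lambda>k. 1/16 * expansion xs k"] scale[of "1/16" "expansion xs"] by simp
  then show ?case using Cons assms(2)[of x] assms(3) by simp
qed

text \<open>Quantifying over all \<open>u\<close> with the given image measures separation in the
  quotient seminorm without forming a quotient. A shared leading digit is stripped by scaling with
  16; at the first differing digit the gap \<open>R / 2\<close> loses at most
  \<open>1/16 * (2 * R + 2 * R) = R / 4\<close> to the tails.\<close>

lemma expansion_separated:
  assumes bd: "\<And>x. x \<in> A \<Longrightarrow> \<nu> x \<le> R" and R: "R > 0"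
    and sep: "\<And>x y u. x \<in> A \<Longrightarrow> y \<in> A \<Longrightarrow> x \<noteq> y \<Longrightarrow>
      \<forall>i<n. mat_app p a u i = mat_app p a x i - mat_app p a y i \<Longrightarrow> \<nu> u \<ge> R / 2"
    and "set xs \<subseteq> A" "set ys \<subseteq> A" "length xs = length ys" "xs \<noteq> ys"
    and "\<forall>i<n. mat_app p a u i = mat_app p a (expansion xs) i - mat_app p a (expansion ys) i"
  shows "\<nu> u \<ge> R / 4 / 16 ^ length xs"
  using assms(6,4,5,7,8)
proof (induction xs ys arbitrary: u rule: list_induct2)
  case Nil
  then show ?case by simp
next
  case (Cons x xs y ys)
  let ?f = "mat_app p a"
  show ?case
  proof (cases "x = y")
    case True
    have "\<forall>i<n. ?f (\<lambda>k. 16 * u k) i = ?f (expansion xs) i - ?f (expansion ys) i"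
      using Cons.prems(4) True by (simp add: mat_app_add mat_app_scale del: times_divide_eq_left)
    then have "R / 4 / 16 ^ length xs \<le> \<nu> (\<lambda>k. 16 * u k)"
      using Cons.prems True by (intro Cons.IH) auto
    then show ?thesis by (simp add: scale)
  next
    case False
    let ?d = "\<lambda>k. 1/16 * (expansion xs k - expansion ys k)"
    have "\<forall>i<n. ?f (\<lambda>k. u k - ?d k) i = ?f x i - ?f y i"
      unfolding mat_app_diff[of p a u] mat_app_scale mat_app_diff
      using Cons.prems(4)
      by (simp add: mat_app_add mat_app_scale right_diff_distrib del: times_divide_eq_left)
    then have "R / 2 \<le> \<nu> (\<lambda>k. u k - ?d k)"
      using Cons.prems False by (intro sep) auto
    also have "\<dots> \<le> \<nu> u + \<nu> ?d" by (rule triangle_diff)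
    also have "\<nu> ?d \<le> 1/16 * (\<nu> (expansion xs) + \<nu> (expansion ys))"
      unfolding scale using triangle_diff[of "expansion xs" "expansion ys"] by simp
    also have "\<dots> \<le> R / 4"
      using expansion_le[of xs A R] expansion_le[of ys A R] Cons.prems bd R by simp
    finally have "R / 4 \<le> \<nu> u" by simp
    moreover have "R / 4 / 16 ^ length (x # xs) \<le> R / 4 / 1"
      using R by (intro divide_left_mono) (auto intro: one_le_power[of "16::real" "Suc _", simplified])
    ultimately show ?thesis by simp
  qed
qed

text \<open>If \<open>card A\<close> exceeded \<open>16 ^ n\<close>, the powers of
  \<open>card A / 16 ^ n\<close> would be unbounded, whereas counting the words of each length
  \<open>L\<close> keeps them below \<open>E ^ n\<close>, with \<open>E\<close> independent of
  \<open>L\<close>.\<close>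

lemma packing_bound:
  assumes fin: "finite A" and bd: "\<And>x. x \<in> A \<Longrightarrow> \<nu> x \<le> R" and R: "R > 0"
    and sep: "\<And>x y u. x \<in> A \<Longrightarrow> y \<in> A \<Longrightarrow> x \<noteq> y \<Longrightarrow>
      \<forall>i<n. mat_app p a u i = mat_app p a x i - mat_app p a y i \<Longrightarrow> \<nu> u \<ge> R / 2"
  shows "real (card A) \<le> 16 ^ n"
proof (rule ccontr)
  let ?f = "mat_app p a"
  assume "\<not> real (card A) \<le> 16 ^ n"
  then have r: "real (card A) / 16 ^ n > 1" by simp
  obtain C where C: "C \<ge> 0" and
    lift: "\<And>u. \<exists>v. (\<forall>i<n. ?f v i = ?f u i) \<and> (\<Sum>k<p. \<bar>v k\<bar>) \<le> C * (\<Sum>i<n. \<bar>?f u i\<bar>)"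
    using bounded_lift[of n p a] by blast
  obtain B where B: "\<And>u. \<nu> u \<le> B * (\<Sum>k<p. \<bar>u k\<bar>)" using dominated by blast
  define F where "F = (\<bar>B\<bar> + 1) * (C + 1)"
  have F: "F > 0" unfolding F_def using C by (intro mult_pos_pos) auto
  define D0 where "D0 = (\<Sum>x\<in>A. \<Sum>i<n. \<bar>?f x i\<bar>)"
  have D0: "D0 \<ge> 0" unfolding D0_def by (intro sum_nonneg) auto
  have fD0: "\<bar>?f x i\<bar> \<le> D0" if "x \<in> A" "i < n" for x i
  proof -
    have "\<bar>?f x i\<bar> \<le> (\<Sum>i<n. \<bar>?f x i\<bar>)" using that by (intro member_le_sum) auto
    also have "\<dots> \<le> D0" unfolding D0_def
      using that fin by (intro member_le_sum[of x A "\<lambda>x. \<Sum>i<n. \<bar>?f x i\<bar>"]) (auto intro: sum_nonneg)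
    finally show ?thesis .
  qed
  \<comment> \<open>Calibrated so that \<open>F * (Suc n * \<eta>)\<close> below equals
    \<open>R / 4 / 16 ^ L\<close>, the separation of words of length \<open>L\<close>.
    \<open>Suc n\<close> gives strictness and a nonzero denominator also for
    \<open>n = 0\<close>.\<close>
  define \<kappa> where "\<kappa> = R / (4 * F * real (Suc n))"
  have \<kappa>: "\<kappa> > 0" using R F by (simp add: \<kappa>_def)
  define E where "E = 5 * (2 * D0 + \<kappa>) / \<kappa>"
  have growth: "(real (card A) / 16 ^ n) ^ L \<le> E ^ n" for L
  proof -
    define W where "W = {xs. set xs \<subseteq> A \<and> length xs = L}"
    define \<eta> where "\<eta> = \<kappa> / 16 ^ L"
    have "finite W" unfolding W_def using fin by (rule finite_lists_length_eq)
    moreover have "\<eta> > 0" using \<kappa> by (simp add: \<eta>_def)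
    \<comment> \<open>The summand \<open>\<kappa>\<close> ensures that the bound is at least
      \<open>\<eta>\<close>, as the grid count demands, even if \<open>D0 = 0\<close>.\<close>
    moreover have "\<bar>?f (expansion xs) i\<bar> \<le> 2 * D0 + \<kappa>" if "xs \<in> W" "i < n" for xs i
    proof -
      interpret f: dominated_seminorm p "\<lambda>u. \<bar>?f u i\<bar>"
        by unfold_locales (auto simp: mat_app_add mat_app_scale abs_mult intro: abs_mat_app_le)
      have "\<bar>?f (expansion xs) i\<bar> \<le> 2 * D0"
        using that D0 fD0 by (intro f.expansion_le[of xs A]) (auto simp: W_def)
      then show ?thesis using \<kappa> by simp
    qed
    moreover have "\<eta> \<le> 2 * D0 + \<kappa>"
    proof -
      have "\<kappa> / 16 ^ L \<le> \<kappa> / 1" using \<kappa> by (intro divide_left_mono) auto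
      then show ?thesis using D0 by (simp add: \<eta>_def)
    qed
    moreover have "\<exists>i<n. \<bar>?f (expansion xs) i - ?f (expansion ys) i\<bar> \<ge> \<eta>"
      if xy: "xs \<in> W" "ys \<in> W" "xs \<noteq> ys" for xs ys
    proof (rule ccontr)
      let ?S = "\<Sum>i<n. \<bar>?f (expansion xs) i - ?f (expansion ys) i\<bar>"
      assume "\<not> ?thesis"
      then have "?S \<le> (\<Sum>i<n. \<eta>)" by (intro sum_mono) (auto simp: not_le intro: less_imp_le)
      also have "\<dots> < real (Suc n) * \<eta>" using \<open>\<eta> > 0\<close> by simp
      finally have S: "?S < real (Suc n) * \<eta>" .
      \<comment> \<open>If the images were close, their difference would have a preimage with small
        entries, hence one of seminorm below the separation.\<close>
      obtain v where v: "\<forall>i<n. ?f v i = ?f (expansion xs) i - ?f (expansion ys) i"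
        "(\<Sum>k<p. \<bar>v k\<bar>) \<le> C * ?S"
        using lift[of "\<lambda>k. expansion xs k - expansion ys k"] by (auto simp: mat_app_diff)
      have "R / 4 / 16 ^ length xs \<le> \<nu> v"
        using xy v(1) by (intro expansion_separated[OF bd R sep]) (auto simp: W_def)
      then have "R / 4 / 16 ^ L \<le> \<nu> v" using xy by (simp add: W_def)
      also have "\<dots> \<le> (\<bar>B\<bar> + 1) * (\<Sum>k<p. \<bar>v k\<bar>)"
        by (rule order_trans[OF B]) (auto intro!: mult_right_mono sum_nonneg)
      also have "\<dots> \<le> (\<bar>B\<bar> + 1) * ((C + 1) * ?S)"
      proof (intro mult_left_mono)
        have "C * ?S \<le> (C + 1) * ?S" by (intro mult_right_mono sum_nonneg) auto
        then show "(\<Sum>k<p. \<bar>v k\<bar>) \<le> (C + 1) * ?S" using v(2) by linarith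
      qed auto
      also have "\<dots> = F * ?S" by (simp add: F_def)
      also have "\<dots> < F * (real (Suc n) * \<eta>)" using S F by simp
      also have "\<dots> = R / 4 / 16 ^ L" using F by (simp add: \<eta>_def \<kappa>_def del: of_nat_Suc)
      finally show False by simp
    qed
    ultimately have "real (card W) \<le> (5 * (2 * D0 + \<kappa>) / \<eta>) ^ n"
      by (rule pigeonhole_grid)
    also have "5 * (2 * D0 + \<kappa>) / \<eta> = E * 16 ^ L" by (simp add: E_def \<eta>_def)
    also have "card W = card A ^ L" unfolding W_def using fin by (rule card_lists_length_eq)
    finally have "real (card A) ^ L \<le> E ^ n * (16 ^ n) ^ L"
      by (simp add: power_mult_distrib flip: power_mult) (simp add: mult.commute)
    then show ?thesis by (simp add: power_divide divide_le_eq)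
  qed
  obtain L where "E ^ n < (real (card A) / 16 ^ n) ^ L" using real_arch_pow[OF r] by blast
  then show False using growth[of L] by simp
qed

end

section \<open>Codes of large Hamming distance\<close>

text \<open>Gilbert-Varshamov: around a maximal code the balls of radius \<open>q / 2\<close> cover
  all words, and each holds at most \<open>2 ^ q * m ^ (q div 2)\<close> of them. Squaring the
  resulting bound avoids a root and the parity of \<open>q\<close>.\<close>

lemma hamming_code_exists:
  fixes q m :: nat
  assumes m: "m \<ge> 1"
  obtains C where "C \<subseteq> PiE {..<q} (\<lambda>_. {..<m})"
    and "\<And>v w. v \<in> C \<Longrightarrow> w \<in> C \<Longrightarrow> v \<noteq> w \<Longrightarrow> q \<le> 2 * card {i. i < q \<and> v i \<noteq> w i}"
    and "m ^ q \<le> card C ^ 2 * 4 ^ q"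
proof -
  define W where "W = PiE {..<q} (\<lambda>_. {..<m})"
  define h where "h v w = card {i. i < q \<and> v i \<noteq> w i}" for v w :: "nat \<Rightarrow> nat"
  define \<G> where "\<G> = {C. C \<subseteq> W \<and> (\<forall>v\<in>C. \<forall>w\<in>C. v \<noteq> w \<longrightarrow> q \<le> 2 * h v w)}"
  have finW: "finite W" unfolding W_def by (intro finite_PiE) auto
  have "finite \<G>" "\<G> \<noteq> {}" using finW by (auto simp: \<G>_def intro: finite_subset[of _ "Pow W"])
  then obtain C where C: "C \<in> \<G>" and max: "\<And>C'. C' \<in> \<G> \<Longrightarrow> C \<subseteq> C' \<Longrightarrow> C = C'"
    using finite_has_maximal by metis
  have CW: "C \<subseteq> W" and finC: "finite C" using C finW by (auto simp: \<G>_def intro: finite_subset)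
  have hsym: "h v w = h w v" for v w by (simp add: h_def eq_commute)
  have cover: "\<exists>v\<in>C. 2 * h v w \<le> q" if w: "w \<in> W" for w
  proof (rule ccontr)
    assume far: "\<not> ?thesis"
    then have "insert w C \<in> \<G>"
      using C w hsym by (auto simp: \<G>_def not_le intro: less_imp_le)
    then have "w \<in> C" using max[of "insert w C"] by blast
    then show False using far by (auto simp: h_def)
  qed
  have ball: "card {w \<in> W. 2 * h v w \<le> q} \<le> 2 ^ q * m ^ (q div 2)" for v
  proof -
    define \<D> where "\<D> = {D. D \<subseteq> {..<q} \<and> card D \<le> q div 2}"
    \<comment> \<open>A word is determined by where it leaves the centre \<open>v\<close> and by its
      values there: at most \<open>2 ^ q\<close> sets of positions, each with at most
      \<open>m ^ (q div 2)\<close> value patterns.\<close>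
    define \<phi> where "\<phi> w = ({i. i < q \<and> v i \<noteq> w i}, restrict w {i. i < q \<and> v i \<noteq> w i})" for w
    have finD: "finite \<D>" by (auto simp: \<D>_def intro: finite_subset[of _ "Pow {..<q}"])
    have "inj_on \<phi> {w \<in> W. 2 * h v w \<le> q}"
    proof (rule inj_onI)
      fix w w' assume w: "w \<in> {w \<in> W. 2 * h v w \<le> q}" "w' \<in> {w \<in> W. 2 * h v w \<le> q}"
        and eq: "\<phi> w = \<phi> w'"
      show "w = w'"
      proof (rule PiE_ext)
        show "w \<in> PiE {..<q} (\<lambda>_. {..<m})" "w' \<in> PiE {..<q} (\<lambda>_. {..<m})"
          using w by (auto simp: W_def)
        fix i assume i: "i \<in> {..<q}"
        have DR: "{i. i < q \<and> v i \<noteq> w i} = {i. i < q \<and> v i \<noteq> w' i} \<and>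
          restrict w {i. i < q \<and> v i \<noteq> w i} = restrict w' {i. i < q \<and> v i \<noteq> w' i}"
          using eq unfolding \<phi>_def prod.inject .
        note D = DR[THEN conjunct1] and R = DR[THEN conjunct2]
        have "v i \<noteq> w i \<longleftrightarrow> v i \<noteq> w' i" using arg_cong[OF D, of "\<lambda>A. i \<in> A"] i by simp
        then show "w i = w' i" using fun_cong[OF R, of i] i by (cases "v i = w i") simp_all
      qed
    qed
    moreover have "\<phi> ` {w \<in> W. 2 * h v w \<le> q} \<subseteq> (SIGMA D:\<D>. PiE D (\<lambda>_. {..<m}))"
    proof (rule image_subsetI)
      fix w assume w: "w \<in> {w \<in> W. 2 * h v w \<le> q}"
      let ?D = "{i. i < q \<and> v i \<noteq> w i}"
      have "?D \<in> \<D>" using w by (auto simp: \<D>_def h_def)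
      moreover have "restrict w ?D \<in> PiE ?D (\<lambda>_. {..<m})"
        using w by (intro restrict_PiE_iff[THEN iffD2]) (auto simp: W_def)
      ultimately show "\<phi> w \<in> (SIGMA D:\<D>. PiE D (\<lambda>_. {..<m}))" by (simp add: \<phi>_def)
    qed
    moreover have "finite (SIGMA D:\<D>. PiE D (\<lambda>_. {..<m}))"
      using finD by (intro finite_SigmaI finite_PiE) (auto simp: \<D>_def intro: finite_subset)
    ultimately have "card {w \<in> W. 2 * h v w \<le> q} \<le> card (SIGMA D:\<D>. PiE D (\<lambda>_. {..<m}))"
      by (rule card_inj_on_le)
    also have "\<dots> = (\<Sum>D\<in>\<D>. card (PiE D (\<lambda>_. {..<m})))"
      using finD by (intro card_SigmaI) (auto simp: \<D>_def intro!: finite_PiE intro: finite_subset)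
    also have "\<dots> \<le> (\<Sum>D\<in>\<D>. m ^ (q div 2))"
    proof (rule sum_mono)
      fix D assume "D \<in> \<D>"
      then have "finite D" "card D \<le> q div 2" by (auto simp: \<D>_def intro: finite_subset)
      then show "card (PiE D (\<lambda>_. {..<m})) \<le> m ^ (q div 2)"
        using m by (simp add: card_PiE power_increasing)
    qed
    also have "\<dots> = card \<D> * m ^ (q div 2)" by simp
    also have "\<dots> \<le> card (Pow {..<q}) * m ^ (q div 2)"
      by (intro mult_right_mono card_mono) (auto simp: \<D>_def)
    finally show ?thesis by (simp add: card_Pow)
  qed
  have "card W \<le> card (\<Union>v\<in>C. {w \<in> W. 2 * h v w \<le> q})"
    using cover finW finC by (intro card_mono) auto
  also have "\<dots> \<le> (\<Sum>v\<in>C. card {w \<in> W. 2 * h v w \<le> q})" using finC by (rule card_UN_le)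
  also have "\<dots> \<le> (\<Sum>v\<in>C. 2 ^ q * m ^ (q div 2))" by (intro sum_mono ball)
  finally have *: "m ^ q \<le> card C * (2 ^ q * m ^ (q div 2))" by (simp add: W_def card_PiE)
  have "m ^ q * m ^ q \<le> (card C * (2 ^ q * m ^ (q div 2)))\<^sup>2"
    unfolding power2_eq_square by (intro mult_mono *) auto
  also have "\<dots> = card C ^ 2 * 4 ^ q * m ^ (2 * (q div 2))"
  proof -
    have "(2 ^ q)\<^sup>2 = (4::nat) ^ q" "(m ^ (q div 2))\<^sup>2 = m ^ (2 * (q div 2))"
      by (simp_all add: power_mult[symmetric] mult.commute[of _ 2] power_mult[of 2 2])
    then show ?thesis by (simp only: power_mult_distrib mult.assoc)
  qed
  also have "\<dots> \<le> card C ^ 2 * 4 ^ q * m ^ q"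
    using m by (intro mult_left_mono power_increasing) auto
  finally have "m ^ q \<le> card C ^ 2 * 4 ^ q" using m by simp
  then show thesis using that[of C] C by (auto simp: \<G>_def W_def h_def)
qed

section \<open>The sparse group norm and the recovery hypothesis\<close>

definition sg_norm ::
    "nat \<Rightarrow> nat \<Rightarrow> (nat \<Rightarrow> nat set) \<Rightarrow> real \<Rightarrow> real \<Rightarrow> (nat \<Rightarrow> real) \<Rightarrow> real" where
  "sg_norm p d G lam lamg u = lam * (\<Sum>k<p. \<bar>u k\<bar>) + lamg * (\<Sum>j<d. L2_set u (G j))"

text \<open>By \<open>recovery\<close>, a sparse \<open>u\<close> has the least objective among all
  preimages of its image, so its objective is the quotient norm that the packing argument
  needs.\<close>

locale sparse_group_recovery =
  fixes d b n s sg p :: nat and G :: "nat \<Rightarrow> nat set" and a :: "nat \<Rightarrow> nat \<Rightarrow> real"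
    and lam lamg :: real
  assumes groups: "equal_groups d b G" and p: "p = d * b"
    and lam: "lam \<ge> 0" and lamg: "lamg \<ge> 0" and lam_pos: "lam + lamg > 0"
    and recovery: "\<And>u v. card {k. k < p \<and> u k \<noteq> 0} \<le> 2 * s \<Longrightarrow>
      card {j. j < d \<and> (\<exists>i\<in>G j. u i \<noteq> 0)} \<le> 2 * sg \<Longrightarrow>
      \<forall>i<n. mat_app p a v i = mat_app p a u i \<Longrightarrow>
      sg_norm p d G lam lamg u \<le> sg_norm p d G lam lamg v"
begin

abbreviation "\<nu> \<equiv> sg_norm p d G lam lamg"

lemma disjoint: "i < d \<Longrightarrow> j < d \<Longrightarrow> i \<noteq> j \<Longrightarrow> G i \<inter> G j = {}"
  using groups by (auto simp: equal_groups_def disjoint_family_on_def)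

lemma UN_groups: "(\<Union>j<d. G j) = {..<p}"
  using groups by (simp add: equal_groups_def p)

lemma card_group: "j < d \<Longrightarrow> card (G j) = b"
  using groups by (simp add: equal_groups_def)

lemma group_subset: "j < d \<Longrightarrow> G j \<subseteq> {..<p}"
  using UN_groups by blast

lemma finite_group: "j < d \<Longrightarrow> finite (G j)"
  using group_subset finite_subset by blast

lemma sum_groups:
  fixes f :: "nat \<Rightarrow> 'c::comm_monoid_add"
  assumes "S \<subseteq> {..<p}"
  shows "(\<Sum>j<d. \<Sum>k\<in>S \<inter> G j. f k) = sum f S"
proof -
  have "(\<Sum>j<d. \<Sum>k\<in>S \<inter> G j. f k) = sum f (\<Union>j\<in>{..<d}. S \<inter> G j)"
    by (rule sum.UNION_disjoint[symmetric]) (use finite_group disjoint in blast)+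
  also have "(\<Union>j\<in>{..<d}. S \<inter> G j) = S" using assms UN_groups by blast
  finally show ?thesis .
qed

sublocale dominated_seminorm p \<nu>
proof
  fix u v :: "nat \<Rightarrow> real"
  have "(\<Sum>k<p. \<bar>u k + v k\<bar>) \<le> (\<Sum>k<p. \<bar>u k\<bar> + \<bar>v k\<bar>)"
    by (intro sum_mono abs_triangle_ineq)
  moreover have "(\<Sum>j<d. L2_set (\<lambda>k. u k + v k) (G j)) \<le> (\<Sum>j<d. L2_set u (G j) + L2_set v (G j))"
    by (intro sum_mono L2_set_triangle_ineq)
  ultimately have
    "lam * (\<Sum>k<p. \<bar>u k + v k\<bar>) \<le> lam * (\<Sum>k<p. \<bar>u k\<bar> + \<bar>v k\<bar>)"
    "lamg * (\<Sum>j<d. L2_set (\<lambda>k. u k + v k) (G j)) \<le> lamg * (\<Sum>j<d. L2_set u (G j) + L2_set v (G j))"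
    using lam lamg by (auto intro: mult_left_mono)
  then show "\<nu> (\<lambda>k. u k + v k) \<le> \<nu> u + \<nu> v"
    unfolding sg_norm_def sum.distrib distrib_left by linarith
next
  fix c :: real and u :: "nat \<Rightarrow> real"
  have "L2_set (\<lambda>k. c * u k) A = \<bar>c\<bar> * L2_set u A" for A
    by (simp add: L2_set_def power_mult_distrib real_sqrt_mult flip: sum_distrib_left)
  then show "\<nu> (\<lambda>k. c * u k) = \<bar>c\<bar> * \<nu> u"
    by (simp add: sg_norm_def abs_mult distrib_left mult.left_commute flip: sum_distrib_left)
next
  have "\<nu> u \<le> (lam + lamg * real d) * (\<Sum>k<p. \<bar>u k\<bar>)" for u
  proof -
    have "L2_set u (G j) \<le> (\<Sum>k<p. \<bar>u k\<bar>)" if "j < d" for j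
      using that group_subset
      by (intro order_trans[OF L2_set_le_sum_abs] sum_mono2) auto
    then have "(\<Sum>j<d. L2_set u (G j)) \<le> (\<Sum>j<d. \<Sum>k<p. \<bar>u k\<bar>)" by (intro sum_mono) auto
    then have "lamg * (\<Sum>j<d. L2_set u (G j)) \<le> lamg * (real d * (\<Sum>k<p. \<bar>u k\<bar>))"
      using lamg by (intro mult_left_mono) auto
    then show ?thesis by (simp add: sg_norm_def algebra_simps)
  qed
  then show "\<exists>B. \<forall>u. \<nu> u \<le> B * (\<Sum>k<p. \<bar>u k\<bar>)" by blast
qed

section \<open>Indicators of separated supports\<close>

text \<open>
  Supports that meet every group in \<open>0\<close> or \<open>t\<close> coordinates make the Cauchy--Schwarz bound below an
  equality on their indicators, so both parts of the objective scale by the same factor.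
\<close>

lemma norm_ge_sum:
  assumes S: "S \<subseteq> {..<p}" and t: "t \<ge> 1" and St: "\<And>j. j < d \<Longrightarrow> card (S \<inter> G j) \<le> t"
  shows "(lam + lamg / sqrt (real t)) * (\<Sum>k\<in>S. \<bar>u k\<bar>) \<le> \<nu> u"
proof -
  have "(\<Sum>k\<in>S \<inter> G j. \<bar>u k\<bar>) \<le> sqrt (real t) * L2_set u (G j)" if j: "j < d" for j
  proof -
    have "(\<Sum>k\<in>S \<inter> G j. \<bar>u k\<bar>) \<le> L2_set (\<lambda>_. 1) (S \<inter> G j) * L2_set u (S \<inter> G j)"
      using L2_set_mult_ineq[of "\<lambda>_. 1" u "S \<inter> G j"] by simp
    also have "\<dots> \<le> sqrt (real t) * L2_set u (G j)"
    proof (intro mult_mono)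
      show "L2_set (\<lambda>_. 1) (S \<inter> G j) \<le> sqrt (real t)" using St[OF j] by (simp add: L2_set_def)
      show "L2_set u (S \<inter> G j) \<le> L2_set u (G j)"
        unfolding L2_set_def using finite_group[OF j] by (intro real_sqrt_le_mono sum_mono2) auto
    qed auto
    finally show ?thesis .
  qed
  then have "(\<Sum>j<d. \<Sum>k\<in>S \<inter> G j. \<bar>u k\<bar>) \<le> (\<Sum>j<d. sqrt (real t) * L2_set u (G j))"
    by (intro sum_mono) auto
  then have "(\<Sum>k\<in>S. \<bar>u k\<bar>) \<le> sqrt (real t) * (\<Sum>j<d. L2_set u (G j))"
    by (simp add: sum_groups[OF S] sum_distrib_left)
  then have "(\<Sum>k\<in>S. \<bar>u k\<bar>) / sqrt (real t) \<le> (\<Sum>j<d. L2_set u (G j))"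
    using t by (simp add: divide_le_eq mult.commute)
  then have "lamg * ((\<Sum>k\<in>S. \<bar>u k\<bar>) / sqrt (real t)) \<le> lamg * (\<Sum>j<d. L2_set u (G j))"
    using lamg by (rule mult_left_mono)
  moreover have "lam * (\<Sum>k\<in>S. \<bar>u k\<bar>) \<le> lam * (\<Sum>k<p. \<bar>u k\<bar>)"
    using lam S by (intro mult_left_mono sum_mono2) auto
  ultimately show ?thesis by (simp add: sg_norm_def distrib_right)
qed

lemma norm_indicator:
  assumes S: "S \<subseteq> {..<p}" and t: "t \<ge> 1" and St: "\<And>j. j < d \<Longrightarrow> card (S \<inter> G j) \<in> {0, t}"
  shows "\<nu> (\<lambda>k. of_bool (k \<in> S)) = (lam + lamg / sqrt (real t)) * real (card S)"
proof -
  have "L2_set (\<lambda>k. of_bool (k \<in> S)) (G j) = real (card (S \<inter> G j)) / sqrt (real t)"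
    if j: "j < d" for j
  proof -
    have "(\<Sum>k\<in>G j. (of_bool (k \<in> S))\<^sup>2) = (\<Sum>k\<in>S \<inter> G j. (1::real))"
      using finite_group[OF j] by (intro sum.mono_neutral_cong_right) auto
    then have "L2_set (\<lambda>k. of_bool (k \<in> S)) (G j) = sqrt (real (card (S \<inter> G j)))"
      by (simp add: L2_set_def)
    \<comment> \<open>For \<open>c\<close> in \<open>{0, t}\<close> one has
      \<open>sqrt c = c / sqrt t\<close>; this is where the restriction to two values
      enters.\<close>
    then show ?thesis using St[OF j] t by (auto simp: real_div_sqrt)
  qed
  then have "(\<Sum>j<d. L2_set (\<lambda>k. of_bool (k \<in> S)) (G j)) = (\<Sum>j<d. real (card (S \<inter> G j))) / sqrt (real t)"
    by (simp add: sum_divide_distrib)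
  also have "(\<Sum>j<d. real (card (S \<inter> G j))) = real (card S)"
    using sum_groups[OF S, of "\<lambda>_. 1::real"] by simp
  finally have "(\<Sum>j<d. L2_set (\<lambda>k. of_bool (k \<in> S)) (G j)) = real (card S) / sqrt (real t)" .
  moreover have "(\<Sum>k<p. \<bar>of_bool (k \<in> S)\<bar>) = (\<Sum>k\<in>S. (1::real))"
    using S by (intro sum.mono_neutral_cong_right) auto
  ultimately show ?thesis by (simp add: sg_norm_def distrib_right)
qed

text \<open>The indicators have norm \<open>\<tau> * q\<close>. A difference of two is sparse enough
  for \<open>recovery\<close>, so every preimage of its image has norm at least
  \<open>\<tau> * card (S - S')\<close>, which is at least half of \<open>\<tau> * q\<close>.
  Packing applies with this radius.\<close>

lemma support_family_bound:
  assumes fin: "finite \<F>" and t: "t \<ge> 1" and q: "q \<ge> 1" "q \<le> s" "q \<le> t * sg"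
    and sub: "\<And>S. S \<in> \<F> \<Longrightarrow> S \<subseteq> {..<p}" and card: "\<And>S. S \<in> \<F> \<Longrightarrow> card S = q"
    and reg: "\<And>S j. S \<in> \<F> \<Longrightarrow> j < d \<Longrightarrow> card (S \<inter> G j) \<in> {0, t}"
    and sep: "\<And>S S'. S \<in> \<F> \<Longrightarrow> S' \<in> \<F> \<Longrightarrow> S \<noteq> S' \<Longrightarrow> q \<le> 2 * card (S - S')"
  shows "real (card \<F>) \<le> 16 ^ n"
proof -
  define x :: "nat set \<Rightarrow> nat \<Rightarrow> real" where "x S = (\<lambda>k. of_bool (k \<in> S))" for S
  define \<tau> where "\<tau> = lam + lamg / sqrt (real t)"
  have \<tau>: "\<tau> > 0"
  proof (cases "lamg = 0")
    case True
    then show ?thesis using lam_pos by (simp add: \<tau>_def)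
  next
    case False
    then have "lamg / sqrt (real t) > 0" using lamg t by simp
    then show ?thesis using lam by (simp add: \<tau>_def)
  qed
  have inj: "inj_on x \<F>"
    by (rule inj_onI) (auto simp: x_def fun_eq_iff of_bool_eq_iff)
  have "finite (x ` \<F>)" using fin by simp
  moreover have "\<nu> u \<le> \<tau> * real q" if "u \<in> x ` \<F>" for u
    using that norm_indicator[OF sub t reg] card by (auto simp: x_def \<tau>_def)
  moreover have "\<tau> * real q > 0" using \<tau> q by simp
  moreover have "\<nu> u \<ge> \<tau> * real q / 2"
    if "y \<in> x ` \<F>" "y' \<in> x ` \<F>" "y \<noteq> y'"
      "\<forall>i<n. mat_app p a u i = mat_app p a y i - mat_app p a y' i" for y y' u
  proof -
    from that(1) obtain S where S1: "S \<in> \<F>" "y = x S" by blast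
    from that(2) obtain S' where S2: "S' \<in> \<F>" "y' = x S'" by blast
    have S: "S \<in> \<F>" "S' \<in> \<F>" "S \<noteq> S'" "y = x S" "y' = x S'" using S1 S2 that(3) by auto
    let ?w = "\<lambda>k. x S k - x S' k"
    define H where "H S = {j. j < d \<and> S \<inter> G j \<noteq> {}}" for S
    \<comment> \<open>Each group met by \<open>S\<close> holds exactly \<open>t\<close> of its
      \<open>q\<close> points, and \<open>q\<close> is at most \<open>t * sg\<close>.\<close>
    have H: "card (H S) \<le> sg" if S: "S \<in> \<F>" for S
    proof -
      have "t * card (H S) = (\<Sum>j\<in>H S. t)" by simp
      also have "\<dots> = (\<Sum>j\<in>H S. card (S \<inter> G j))"
      proof (rule sum.cong)
        fix j assume "j \<in> H S"
        then have j: "j < d" "S \<inter> G j \<noteq> {}" by (auto simp: H_def)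
        then have "card (S \<inter> G j) \<noteq> 0" using finite_group[of j] by simp
        then show "t = card (S \<inter> G j)" using reg[OF S j(1)] by simp
      qed simp
      also have "\<dots> \<le> (\<Sum>j<d. card (S \<inter> G j))" by (intro sum_mono2) (auto simp: H_def)
      also have "\<dots> = q" using sum_groups[OF sub[OF S], of "\<lambda>_. 1::nat"] card[OF S] by simp
      finally have "t * card (H S) \<le> t * sg" using q(3) by linarith
      then show ?thesis using t by simp
    qed
    have finS: "finite T" if "T \<in> \<F>" for T using sub[OF that] finite_subset by blast
    have "card {k. k < p \<and> ?w k \<noteq> 0} \<le> card (S \<union> S')"
      using finS S by (intro card_mono) (auto simp: x_def)
    also have "\<dots> \<le> 2 * s" using card_Un_le[of S S'] card S q by simp
    finally have 1: "card {k. k < p \<and> ?w k \<noteq> 0} \<le> 2 * s" .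
    have "card {j. j < d \<and> (\<exists>i\<in>G j. ?w i \<noteq> 0)} \<le> card (H S \<union> H S')"
      by (intro card_mono) (auto simp: H_def x_def)
    also have "\<dots> \<le> 2 * sg" using card_Un_le[of "H S" "H S'"] H[OF S(1)] H[OF S(2)] by linarith
    finally have 2: "card {j. j < d \<and> (\<exists>i\<in>G j. ?w i \<noteq> 0)} \<le> 2 * sg" .
    have "\<nu> ?w \<le> \<nu> u"
      by (rule recovery[OF 1 2]) (use that(4) S in \<open>simp add: mat_app_diff\<close>)
    \<comment> \<open>The sum runs over \<open>S\<close> alone, which meets a group in at most
      \<open>t\<close> coordinates; the union with \<open>S'\<close> may meet it in more.\<close>
    moreover have "\<tau> * (\<Sum>k\<in>S. \<bar>?w k\<bar>) \<le> \<nu> ?w"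
      unfolding \<tau>_def using reg[OF S(1)] by (intro norm_ge_sum sub S t) fastforce
    moreover have "(\<Sum>k\<in>S. \<bar>?w k\<bar>) = (\<Sum>k\<in>S - S'. 1)"
      using finS S by (intro sum.mono_neutral_cong_right) (auto simp: x_def)
    moreover have "real q \<le> 2 * real (card (S - S'))" using sep[OF S(1-3)] by linarith
    then have "\<tau> * real q / 2 \<le> \<tau> * real (card (S - S'))" using \<tau> by simp
    ultimately show ?thesis by simp
  qed
  ultimately have "real (card (x ` \<F>)) \<le> 16 ^ n" by (rule packing_bound)
  then show ?thesis using inj by (simp add: card_image)
qed

section \<open>Supports read off from codes\<close>

text \<open>A code word \<open>w\<close> becomes the support of all \<open>e i (w i)\<close>, one
  element from each of \<open>q\<close> disjoint blocks of \<open>m\<close> coordinates. Set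
  difference then counts the positions where two words differ, so a code becomes a separated family.
  Squaring \<open>16 ^ n\<close> gives \<open>256 ^ n\<close>.\<close>

lemma block_code_bound:
  assumes m: "m \<ge> 1" and t: "t \<ge> 1" and q: "q \<ge> 1" "q \<le> s" "q \<le> t * sg"
    and inj: "inj_on (\<lambda>(i, l). e i l) ({..<q} \<times> {..<m})"
    and sub: "\<And>i l. i < q \<Longrightarrow> l < m \<Longrightarrow> e i l < p"
    and reg: "\<And>w j. (\<And>i. i < q \<Longrightarrow> w i < m) \<Longrightarrow> j < d \<Longrightarrow>
      card ((\<lambda>i. e i (w i)) ` {..<q} \<inter> G j) \<in> {0, t}"
  shows "real m ^ q \<le> 4 ^ q * 256 ^ n"
proof -
  obtain C where C: "C \<subseteq> PiE {..<q} (\<lambda>_. {..<m})"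
    and far: "\<And>v w. v \<in> C \<Longrightarrow> w \<in> C \<Longrightarrow> v \<noteq> w \<Longrightarrow> q \<le> 2 * card {i. i < q \<and> v i \<noteq> w i}"
    and size: "m ^ q \<le> card C ^ 2 * 4 ^ q"
    using hamming_code_exists[OF m] by blast
  define S where "S w = (\<lambda>i. e i (w i)) ` {..<q}" for w
  have lt: "w i < m" if "w \<in> C" "i < q" for w i using that C by auto
  have eD: "i = j \<and> k = l" if "e i k = e j l" "i < q" "j < q" "k < m" "l < m" for i j k l
    using inj_onD[OF inj, of "(i, k)" "(j, l)"] that by simp
  have injw: "inj_on (\<lambda>i. e i (w i)) {..<q}" if "w \<in> C" for w
  proof (rule inj_onI)
    fix i j assume "i \<in> {..<q}" "j \<in> {..<q}" "e i (w i) = e j (w j)"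
    then show "i = j" using eD[of i "w i" j "w j"] lt[OF that] by simp
  qed
  have card_diff: "card (S v - S w) = card {i. i < q \<and> v i \<noteq> w i}"
    if vw: "v \<in> C" "w \<in> C" for v w
  proof -
    have "e i (v i) \<in> S w \<longleftrightarrow> v i = w i" if i: "i < q" for i
    proof
      assume "e i (v i) \<in> S w"
      then obtain j where j: "j < q" "e i (v i) = e j (w j)" by (auto simp: S_def)
      then have "i = j \<and> v i = w j" using lt[OF vw(1) i] lt[OF vw(2) j(1)] i by (intro eD)
      then show "v i = w i" by auto
    qed (use i in \<open>simp add: S_def\<close>)
    then have "S v - S w = (\<lambda>i. e i (v i)) ` {i. i < q \<and> v i \<noteq> w i}"
      unfolding S_def[of v] by auto
    moreover have "inj_on (\<lambda>i. e i (v i)) {i. i < q \<and> v i \<noteq> w i}"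
      using injw[OF vw(1)] by (rule inj_on_subset) auto
    ultimately show ?thesis by (simp add: card_image)
  qed
  have sep: "q \<le> 2 * card (S v - S w)" if "v \<in> C" "w \<in> C" "v \<noteq> w" for v w
    using far that card_diff by simp
  have injS: "inj_on S C"
  proof (rule inj_onI, rule ccontr)
    fix v w assume "v \<in> C" "w \<in> C" "S v = S w" "v \<noteq> w"
    then show False using sep[of v w] q by simp
  qed
  have finC: "finite C" using C by (rule finite_subset) (auto intro: finite_PiE)
  have "real (card (S ` C)) \<le> 16 ^ n"
  proof (rule support_family_bound[OF _ t q])
    show "finite (S ` C)" using finC by simp
    show "T \<subseteq> {..<p}" if "T \<in> S ` C" for T using that sub lt by (auto simp: S_def)
    show "card T = q" if "T \<in> S ` C" for T
      using that injw by (auto simp: S_def card_image)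
    show "card (T \<inter> G j) \<in> {0, t}" if T: "T \<in> S ` C" and j: "j < d" for T j
    proof -
      obtain w where w: "w \<in> C" "T = S w" using T by blast
      show ?thesis unfolding w(2) S_def using lt[OF w(1)] j by (rule reg)
    qed
    show "q \<le> 2 * card (T - T')" if T: "T \<in> S ` C" "T' \<in> S ` C" "T \<noteq> T'" for T T'
    proof -
      obtain v w where "v \<in> C" "T = S v" "w \<in> C" "T' = S w" using T by blast
      then show ?thesis using sep[of v w] T(3) by auto
    qed
  qed
  then have "real (card C) \<le> 16 ^ n" using injS by (simp add: card_image)
  then have "real (card C) ^ 2 \<le> (16 ^ n) ^ 2" by (intro power_mono) auto
  also have "\<dots> = (256::real) ^ n" by (simp add: power_mult[symmetric] mult.commute[of n] power_mult)
  finally have "real (card C) ^ 2 * 4 ^ q \<le> 256 ^ n * 4 ^ q" by (rule mult_right_mono) simp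
  moreover have "real (m ^ q) \<le> real (card C ^ 2 * 4 ^ q)" using size by (simp only: of_nat_le_iff)
  then have "real m ^ q \<le> real (card C) ^ 2 * 4 ^ q"
    by (simp only: of_nat_mult of_nat_power of_nat_numeral)
  ultimately show ?thesis unfolding mult.commute[of "4 ^ q"] by (rule order_trans[rotated])
qed

text \<open>There are \<open>sg\<close> disjoint blocks of \<open>d div sg\<close> groups. A word
  picks one group from each block, represented by one fixed coordinate, so every group is met at
  most once and \<open>t = 1\<close>.\<close>

lemma group_code_bound:
  assumes sg: "sg \<ge> 1" "sg \<le> d" "sg \<le> s" and b: "b \<ge> 1"
  shows "real (d div sg) ^ sg \<le> 4 ^ sg * 256 ^ n"
proof -
  define m where "m = d div sg"
  have m: "m \<ge> 1" using sg by (simp add: m_def div_greater_zero_iff Suc_leI)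
  have "\<forall>j<d. \<exists>k. k \<in> G j" using card_group b by (metis card.empty ex_in_conv not_one_le_zero)
  then obtain g where g: "\<And>j. j < d \<Longrightarrow> g j \<in> G j" by metis
  have idx: "i * m + l < d" if "i < sg" "l < m" for i l
  proof -
    have "i * m + l < (i + 1) * m" using that by simp
    also have "\<dots> \<le> sg * m" using that by (intro mult_right_mono) auto
    also have "\<dots> \<le> d" by (simp add: m_def)
    finally show ?thesis .
  qed
  have gD: "i = j" if "g i \<in> G j" "i < d" "j < d" for i j
    using disjoint[of i j] g that by blast
  show ?thesis unfolding m_def[symmetric]
  proof (rule block_code_bound[OF m, where t = 1 and e = "\<lambda>i l. g (i * m + l)"])
    show "inj_on (\<lambda>(i, l). g (i * m + l)) ({..<sg} \<times> {..<m})"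
    proof (rule inj_onI, clarsimp)
      fix i l i' l' assume *: "i < sg" "l < m" "i' < sg" "l' < m" "g (i * m + l) = g (i' * m + l')"
      then have eq: "i * m + l = i' * m + l'" using gD g idx by metis
      have "(i * m + l) div m = i" "(i' * m + l') div m = i'" using * by auto
      then show "i = i' \<and> l = l'" using eq by auto
    qed
    show "g (i * m + l) < p" if "i < sg" "l < m" for i l
      using g[OF idx[OF that]] group_subset[OF idx[OF that]] by auto
    show "card ((\<lambda>i. g (i * m + w i)) ` {..<sg} \<inter> G j) \<in> {0, 1}"
      if "\<And>i. i < sg \<Longrightarrow> w i < m" "j < d" for w j
    proof -
      have "(\<lambda>i. g (i * m + w i)) ` {..<sg} \<inter> G j \<subseteq> {g j}"
      proof
        fix k assume "k \<in> (\<lambda>i. g (i * m + w i)) ` {..<sg} \<inter> G j"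
        then obtain i where i: "i < sg" "k = g (i * m + w i)" "k \<in> G j" by blast
        then show "k \<in> {g j}" using gD[of "i * m + w i" j] idx[of i "w i"] that by simp
      qed
      then have "card ((\<lambda>i. g (i * m + w i)) ` {..<sg} \<inter> G j) \<le> card {g j}"
        by (intro card_mono) auto
      then show ?thesis by (simp add: le_Suc_eq)
    qed
  qed (use sg in auto)
qed

text \<open>With \<open>t = s div sg\<close>, each of the first \<open>sg\<close> groups contains
  \<open>t\<close> blocks of \<open>b div t\<close> coordinates, and a word picks one coordinate
  from every block. These groups are met in exactly \<open>t\<close> coordinates, the others in
  none.\<close>

lemma within_group_code_bound:
  assumes sg: "sg \<ge> 1" "sg \<le> d" "sg \<le> s" "s \<le> sg * b"
  shows "real (b div (s div sg)) ^ (sg * (s div sg)) \<le> 4 ^ (sg * (s div sg)) * 256 ^ n"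
proof -
  define t where "t = s div sg"
  define m where "m = b div t"
  have t: "t \<ge> 1" using sg by (simp add: t_def div_greater_zero_iff Suc_leI)
  have "t \<le> b"
    using sg div_le_mono[OF sg(4), of sg] by (simp add: t_def)
  then have m: "m \<ge> 1" using t by (simp add: m_def div_greater_zero_iff Suc_leI)
  have "\<forall>j<d. \<exists>h. bij_betw h {0..<b} (G j)"
    using ex_bij_betw_nat_finite[OF finite_group] card_group by metis
  then obtain h where h: "\<And>j. j < d \<Longrightarrow> bij_betw (h j) {0..<b} (G j)" by metis
  have idx: "r * m + l < b" if "r < t" "l < m" for r l
  proof -
    have "r * m + l < (r + 1) * m" using that by simp
    also have "\<dots> \<le> t * m" using that by (intro mult_right_mono) auto
    also have "\<dots> \<le> b" by (simp add: m_def)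
    finally show ?thesis .
  qed
  \<comment> \<open>Position \<open>i\<close> addresses block \<open>i mod t\<close> of group
    \<open>i div t\<close>; \<open>h\<close> enumerates the coordinates of each group.\<close>
  define e where "e i l = h (i div t) ((i mod t) * m + l)" for i l
  have grp: "i div t < d" if "i < sg * t" for i
    using that sg less_mult_imp_div_less[of i sg t] by simp
  have eG: "e i l \<in> G (i div t)" if "i < sg * t" "l < m" for i l
    using bij_betwE[OF h[OF grp[OF that(1)]]] idx[of "i mod t" l] that t by (auto simp: e_def)
  have eGD: "i div t = j" if "e i l \<in> G j" "i < sg * t" "l < m" "j < d" for i l j
    using eG[OF that(2,3)] disjoint[of "i div t" j] grp that by blast
  have eD: "i = j \<and> k = l" if *: "e i k = e j l" "i < sg * t" "j < sg * t" "k < m" "l < m" for i j k l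
  proof -
    have d: "i div t = j div t" using eGD eG grp * by metis
    have "inj_on (h (i div t)) {0..<b}" using h[OF grp[OF *(2)]] by (rule bij_betw_imp_inj_on)
    then have eq: "(i mod t) * m + k = (j mod t) * m + l"
      using * d t idx[of "i mod t" k] idx[of "j mod t" l] by (auto simp: e_def dest: inj_onD)
    have "((i mod t) * m + k) div m = i mod t" "((j mod t) * m + l) div m = j mod t" using * by auto
    then have "i mod t = j mod t" using eq by simp
    then show ?thesis using eq d by (metis add_left_imp_eq div_mult_mod_eq)
  qed
  show ?thesis unfolding m_def[symmetric] t_def[symmetric]
  proof (rule block_code_bound[OF m t, where e = e])
    show "inj_on (\<lambda>(i, l). e i l) ({..<sg * t} \<times> {..<m})"
    proof (rule inj_onI, clarsimp)
      fix i l i' l' assume "i < sg * t" "l < m" "i' < sg * t" "l' < m" "e i l = e i' l'"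
      then show "i = i' \<and> l = l'" by (intro eD)
    qed
    show "e i l < p" if "i < sg * t" "l < m" for i l
      using eG[OF that] group_subset[OF grp[OF that(1)]] by auto
    show "card ((\<lambda>i. e i (w i)) ` {..<sg * t} \<inter> G j) \<in> {0, t}"
      if w: "\<And>i. i < sg * t \<Longrightarrow> w i < m" and j: "j < d" for w j
    proof -
      have "e i (w i) \<in> G j \<longleftrightarrow> i div t = j" if "i < sg * t" for i
        using eG[OF that w[OF that]] eGD[OF _ that w[OF that] j] by auto
      then have "(\<lambda>i. e i (w i)) ` {..<sg * t} \<inter> G j = (\<lambda>i. e i (w i)) ` {i. i < sg * t \<and> i div t = j}"
        by auto
      moreover have "inj_on (\<lambda>i. e i (w i)) {i. i < sg * t \<and> i div t = j}"
      proof (rule inj_onI)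
        fix i i' assume "i \<in> {i. i < sg * t \<and> i div t = j}" "i' \<in> {i. i < sg * t \<and> i div t = j}"
          "e i (w i) = e i' (w i')"
        then show "i = i'" using eD[of i "w i" i' "w i'"] w by simp
      qed
      ultimately have *: "card ((\<lambda>i. e i (w i)) ` {..<sg * t} \<inter> G j) = card {i. i < sg * t \<and> i div t = j}"
        by (simp add: card_image)
      show ?thesis
      proof (cases "j < sg")
        case True
        have "(j + 1) * t \<le> sg * t" using True by (intro mult_right_mono) auto
        then have jt: "j * t + t \<le> sg * t" by simp
        have div_iff: "i div t = j \<longleftrightarrow> j * t \<le> i \<and> i < j * t + t" for i
        proof
          assume "i div t = j"
          then show "j * t \<le> i \<and> i < j * t + t"
            using div_times_less_eq_dividend[of i t] dividend_less_div_times[of t i] t by auto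
        next
          assume "j * t \<le> i \<and> i < j * t + t"
          then show "i div t = j" by (intro div_nat_eqI) (simp_all add: algebra_simps)
        qed
        have "{i. i < sg * t \<and> i div t = j} = {j * t..<j * t + t}"
        proof (rule Set.set_eqI)
          fix i
          show "i \<in> {i. i < sg * t \<and> i div t = j} \<longleftrightarrow> i \<in> {j * t..<j * t + t}"
            unfolding div_iff mem_Collect_eq atLeastLessThan_iff using jt by linarith
        qed
        then show ?thesis using * by simp
      next
        case False
        then have "{i. i < sg * t \<and> i div t = j} = {}" by (auto dest: less_mult_imp_div_less)
        then show ?thesis using * by simp
      qed
    qed
    show "sg * t \<le> s" by (simp add: t_def)
  qed (use sg t in auto)
qed

section \<open>Linear bound on the sparsity\<close>

text \<open>The zero vector has the same image as \<open>u\<close>, so \<open>recovery\<close>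
  forces the norm of \<open>u\<close> to be at most 0, while one coordinate already bounds it from
  below.\<close>

lemma kernel_sparse_zero:
  assumes "card {k. k < p \<and> u k \<noteq> 0} \<le> 2 * s" "card {j. j < d \<and> (\<exists>i\<in>G j. u i \<noteq> 0)} \<le> 2 * sg"
    and "\<forall>i<n. mat_app p a u i = 0" and k: "k < p"
  shows "u k = 0"
proof -
  have "\<nu> u \<le> \<nu> (\<lambda>_. 0)" using assms by (intro recovery) (auto simp: mat_app_def)
  then have "\<nu> u \<le> 0" by (simp add: zero)
  moreover have "(lam + lamg) * \<bar>u k\<bar> \<le> \<nu> u"
  proof -
    have "card ({k} \<inter> G j) \<le> 1" for j using card_mono[of "{k}" "{k} \<inter> G j"] by simp
    then show ?thesis using norm_ge_sum[of "{k}" 1 u] k by simp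
  qed
  ultimately have "(lam + lamg) * \<bar>u k\<bar> \<le> 0" by linarith
  then show ?thesis using lam_pos by (simp add: mult_le_0_iff)
qed

text \<open>A vector supported on \<open>s\<close> fixed coordinates within \<open>sg\<close> groups
  is determined by its image. The \<open>2 ^ s\<close> points of the cube on these coordinates thus
  stay separated in the maximum norm, and packing gives \<open>2 ^ s <= 16 ^ n\<close>.\<close>

lemma sparsity_le:
  assumes sg: "sg \<le> d" "s \<le> sg * b"
  shows "s \<le> 4 * n"
proof -
  have "card (\<Union>j<sg. G j) = (\<Sum>j<sg. card (G j))"
    using sg finite_group disjoint by (intro card_UN_disjoint) auto
  also have "\<dots> = sg * b" using sg card_group by simp
  finally obtain S where S: "S \<subseteq> (\<Union>j<sg. G j)" "card S = s"
    using sg obtain_subset_with_card_n by metis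
  have Sp: "S \<subseteq> {..<p}" using S(1) UN_groups sg(1) by fastforce
  then have finS: "finite S" by (rule finite_subset) simp
  \<comment> \<open>The inserted 0 keeps the maximum defined even for empty
    \<open>S\<close>.\<close>
  define \<sigma> where "\<sigma> u = Max (insert 0 ((\<lambda>k. \<bar>u k\<bar>) ` S))" for u :: "nat \<Rightarrow> real"
  have \<sigma>_ge: "\<bar>u k\<bar> \<le> \<sigma> u" if "k \<in> S" for u k using finS that by (auto simp: \<sigma>_def)
  have \<sigma>_nonneg: "0 \<le> \<sigma> u" for u using finS by (simp add: \<sigma>_def)
  have \<sigma>_le: "\<sigma> u \<le> B" if "0 \<le> B" "\<And>k. k \<in> S \<Longrightarrow> \<bar>u k\<bar> \<le> B" for u B
    using finS that by (auto simp: \<sigma>_def)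
  have \<sigma>_scale_le: "\<sigma> (\<lambda>k. c * u k) \<le> \<bar>c\<bar> * \<sigma> u" for c u
    by (rule \<sigma>_le) (auto simp: abs_mult \<sigma>_nonneg intro!: mult_left_mono \<sigma>_ge)
  interpret \<sigma>: dominated_seminorm p \<sigma>
  proof
    fix u v :: "nat \<Rightarrow> real"
    show "\<sigma> (\<lambda>k. u k + v k) \<le> \<sigma> u + \<sigma> v"
    proof (rule \<sigma>_le)
      fix k assume "k \<in> S"
      then show "\<bar>u k + v k\<bar> \<le> \<sigma> u + \<sigma> v" using \<sigma>_ge[of k u] \<sigma>_ge[of k v] by linarith
    qed (simp add: \<sigma>_nonneg)
  next
    fix c :: real and u :: "nat \<Rightarrow> real"
    show "\<sigma> (\<lambda>k. c * u k) = \<bar>c\<bar> * \<sigma> u"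
    proof (cases "c = 0")
      case True
      then show ?thesis using \<sigma>_scale_le[of 0 u] \<sigma>_nonneg[of "\<lambda>k. 0"] by simp
    next
      case False
      have "\<bar>c\<bar> * \<sigma> (\<lambda>k. 1 / c * (c * u k)) \<le> \<bar>c\<bar> * (\<bar>1 / c\<bar> * \<sigma> (\<lambda>k. c * u k))"
        by (intro mult_left_mono \<sigma>_scale_le) simp
      then have "\<bar>c\<bar> * \<sigma> u \<le> \<sigma> (\<lambda>k. c * u k)" using False by (simp add: abs_divide)
      then show ?thesis using \<sigma>_scale_le[of c u] by simp
    qed
  next
    have "\<sigma> u \<le> 1 * (\<Sum>k<p. \<bar>u k\<bar>)" for u
    proof (rule \<sigma>_le)
      fix k assume "k \<in> S"
      then show "\<bar>u k\<bar> \<le> 1 * (\<Sum>k<p. \<bar>u k\<bar>)"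
        using Sp member_le_sum[of k "{..<p}" "\<lambda>k. \<bar>u k\<bar>"] by auto
    qed (simp add: sum_nonneg)
    then show "\<exists>B. \<forall>u. \<sigma> u \<le> B * (\<Sum>k<p. \<bar>u k\<bar>)" by blast
  qed
  \<comment> \<open>Columns outside \<open>S\<close> are cleared because \<open>\<sigma>\<close>
    does not see these coordinates; a preimage \<open>u\<close> then matters only through its
    entries on \<open>S\<close>.\<close>
  define a' where "a' i k = (if k \<in> S then a i k else 0)" for i k
  define x :: "nat set \<Rightarrow> nat \<Rightarrow> real" where "x T = (\<lambda>k. of_bool (k \<in> T))" for T
  have "finite (x ` Pow S)" using finS by simp
  moreover have "\<sigma> y \<le> 1" if "y \<in> x ` Pow S" for y
    using that by (intro \<sigma>_le) (auto simp: x_def)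
  moreover have "(1::real) > 0" by simp
  moreover have "\<sigma> u \<ge> 1 / 2"
    if y: "y \<in> x ` Pow S" "y' \<in> x ` Pow S" "y \<noteq> y'"
      and u: "\<forall>i<n. mat_app p a' u i = mat_app p a' y i - mat_app p a' y' i" for y y' u
  proof -
    \<comment> \<open>The deviation of \<open>u\<close> from \<open>y - y'\<close> on
      \<open>S\<close>. It is sparse and in the kernel of \<open>a\<close>, hence zero, so
      \<open>u\<close> has absolute value 1 wherever the two cube points differ.\<close>
    let ?w = "\<lambda>k. if k \<in> S then u k - (y k - y' k) else 0"
    have "mat_app p a ?w i = mat_app p a' (\<lambda>k. u k - (y k - y' k)) i" for i
      unfolding mat_app_def a'_def by (intro sum.cong) auto
    then have ker: "\<forall>i<n. mat_app p a ?w i = 0" using u by (simp add: mat_app_diff)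
    have "card {k. k < p \<and> ?w k \<noteq> 0} \<le> card S" using finS by (intro card_mono) auto
    then have 1: "card {k. k < p \<and> ?w k \<noteq> 0} \<le> 2 * s" using S(2) by linarith
    have "{j. j < d \<and> (\<exists>i\<in>G j. ?w i \<noteq> 0)} \<subseteq> {..<sg}"
    proof
      fix j assume "j \<in> {j. j < d \<and> (\<exists>i\<in>G j. ?w i \<noteq> 0)}"
      then obtain i where i: "j < d" "i \<in> G j" "i \<in> S" by (auto split: if_splits)
      then obtain l where l: "l < sg" "i \<in> G l" using S(1) by blast
      then have "l = j" using disjoint[of l j] i sg by auto
      then show "j \<in> {..<sg}" using l by simp
    qed
    from card_mono[OF _ this] have 2: "card {j. j < d \<and> (\<exists>i\<in>G j. ?w i \<noteq> 0)} \<le> 2 * sg" by simp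
    from y obtain T T' where T: "T \<subseteq> S" "T' \<subseteq> S" "y = x T" "y' = x T'" by blast
    then have "T \<noteq> T'" using y(3) by auto
    then obtain k where k: "k \<in> S" "k \<in> T \<longleftrightarrow> k \<notin> T'" using T(1,2) by blast
    have "?w k = 0" using Sp k by (intro kernel_sparse_zero[OF 1 2 ker]) auto
    then have "\<bar>u k\<bar> = 1" using k T by (cases "k \<in> T") (auto simp: x_def)
    then show ?thesis using \<sigma>_ge[OF k(1), of u] by linarith
  qed
  ultimately have "real (card (x ` Pow S)) \<le> 16 ^ n" by (rule \<sigma>.packing_bound)
  moreover have "inj_on x (Pow S)"
    by (rule inj_onI) (auto simp: x_def fun_eq_iff of_bool_eq_iff)
  ultimately have "(2::real) ^ s \<le> 16 ^ n" using finS S(2) by (simp add: card_image card_Pow)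
  also have "(16::real) ^ n = 2 ^ (4 * n)" by (simp add: power_mult)
  finally show ?thesis by simp
qed

section \<open>Logarithmic form and constants\<close>

text \<open>Taking logarithms with \<open>ln 2 <= 1\<close>, the powers of 4 and 256 contribute
  \<open>2 * q\<close> and \<open>8 * n\<close>. The third \<open>q\<close> pays for
  \<open>y <= 2 * m\<close>, which lets \<open>y\<close> be a ratio that \<open>m\<close> rounds
  down.\<close>

lemma ln_le_of_code_bound:
  assumes "m \<ge> 1" "real m ^ q \<le> 4 ^ q * 256 ^ n" "0 < y" "y \<le> 2 * real m"
  shows "real q * ln y \<le> 3 * real q + 8 * real n"
proof -
  have ln2: "ln (2::real) \<le> 1" using ln_2_less_1 by simp
  have "ln (real m ^ q) \<le> ln (4 ^ q * 256 ^ n)" using assms by simp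
  also have "\<dots> = real q * ln 4 + real n * ln 256" by (simp add: ln_mult ln_realpow)
  also have "ln (4::real) = 2 * ln 2" using ln_realpow[of 2 2] by simp
  also have "ln (256::real) = 8 * ln 2" using ln_realpow[of 2 8] by simp
  finally have "real q * ln (real m) \<le> real q * (2 * ln 2) + real n * (8 * ln 2)"
    using assms by (simp add: ln_realpow)
  moreover have "ln y \<le> ln (2 * real m)" using assms by simp
  then have "ln y \<le> ln 2 + ln (real m)" using assms by (simp add: ln_mult)
  then have "real q * ln y \<le> real q * (ln 2 + ln (real m))" by (rule mult_left_mono) simp
  moreover have "real q * ln 2 \<le> real q * 1" "real n * ln 2 \<le> real n * 1"
    using ln2 by (intro mult_left_mono; simp)+
  ultimately show ?thesis by (simp add: algebra_simps)
qed

text \<open>\<open>64 = 20 + 40 + 4\<close>: the code over groups, the code within groups, and the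
  summand \<open>s\<close> produced by the factor \<open>exp 1\<close>, all expressed in
  \<open>n\<close> through \<open>s <= 4 * n\<close>.\<close>

lemma sample_size_ge:
  assumes sg: "sg \<ge> 1" "sg \<le> d" "sg \<le> s" "s \<le> sg * b" and b: "b \<ge> 1"
  shows "real n \<ge> 1/64 * (real sg * ln (real d / real sg)
                      + real s * ln (exp 1 * real sg * real b / real s))"
proof -
  have s4: "real s \<le> 4 * real n" using sparsity_le[OF sg(2,4)] by linarith
  \<comment> \<open>Rounding a ratio of at least 1 down costs at most a factor 2.\<close>
  have div_le: "real i / real j \<le> 2 * real (i div j)" "i div j \<ge> 1" if "1 \<le> j" "j \<le> i" for i j :: nat
  proof -
    show 1: "i div j \<ge> 1" using that by (simp add: div_greater_zero_iff Suc_leI)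
    have "i < j + (i div j) * j" using that dividend_less_div_times[of j i] by simp
    also have "\<dots> \<le> 2 * (i div j) * j" using mult_right_mono[OF 1, of j] by simp
    finally have "real i \<le> real (2 * (i div j) * j)" by linarith
    then show "real i / real j \<le> 2 * real (i div j)" using that by (simp add: divide_le_eq)
  qed
  have "real sg * ln (real d / real sg) \<le> 3 * real sg + 8 * real n"
    using sg b div_le by (intro ln_le_of_code_bound[OF _ group_code_bound]) auto
  moreover have "real sg \<le> real s" using sg by simp
  ultimately have 1: "real sg * ln (real d / real sg) \<le> 20 * real n" using s4 by linarith
  define t where "t = s div sg"
  define y where "y = real sg * real b / real s"
  have t: "t \<ge> 1" unfolding t_def using sg div_le by blast
  have tb: "t \<le> b" using sg div_le_mono[OF sg(4), of sg] by (simp add: t_def)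
  have y1: "y \<ge> 1" using sg by (simp add: y_def flip: of_nat_mult)
  have ts: "sg * t \<le> s" by (simp add: t_def)
  \<comment> \<open>Since \<open>sg * t <= s\<close>, \<open>y\<close> is at most
    \<open>b / t\<close>, which the alphabet size \<open>b div t\<close> controls.\<close>
  have "y \<le> real sg * real b / real (sg * t)"
    unfolding y_def using ts sg t by (intro divide_left_mono) (auto simp flip: of_nat_mult)
  also have "\<dots> = real b / real t" using sg by simp
  also have "\<dots> \<le> 2 * real (b div t)" using t tb by (rule div_le)
  finally have "y \<le> 2 * real (b div t)" .
  then have "real (sg * t) * ln y \<le> 3 * real (sg * t) + 8 * real n"
    using y1 div_le(2)[OF t tb] within_group_code_bound[OF sg]
    by (intro ln_le_of_code_bound[of "b div t"]) (auto simp: t_def)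
  \<comment> \<open>The code has only \<open>sg * t\<close> positions, but these are at least half
    of \<open>s\<close>; this doubles 20 to 40.\<close>
  moreover have "real s \<le> 2 * real (sg * t)"
    using div_le(1)[of sg s] sg by (simp add: t_def divide_le_eq mult_ac)
  then have "real s * ln y \<le> 2 * real (sg * t) * ln y" using y1 by (intro mult_right_mono) auto
  moreover have "real (sg * t) \<le> real s" using ts by (simp only: of_nat_le_iff)
  ultimately have 2: "real s * ln y \<le> 40 * real n" using s4 by linarith
  have "ln (exp 1 * real sg * real b / real s) = ln (exp 1 * y)" by (simp add: y_def mult.assoc)
  also have "\<dots> = 1 + ln y" using y1 by (simp add: ln_mult)
  finally have "real s * ln (exp 1 * real sg * real b / real s) = real s + real s * ln y"
    by (simp add: distrib_left)
  then have "real sg * ln (real d / real sg) + real s * ln (exp 1 * real sg * real b / real s)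
      \<le> 64 * real n"
    using 1 2 s4 by simp
  then show ?thesis by simp
qed

end

section \<open>Transfer to matrices and vectors\<close>

theorem theorem2:
  "\<exists>c::real. c > 0 \<and>
    (\<forall>(d::nat) (b::nat) (n::nat) (s::nat) (sg::nat) (G :: nat \<Rightarrow> nat set) (X :: real mat).
       d \<ge> 3 \<longrightarrow> b \<ge> 3 \<longrightarrow> equal_groups d b G \<longrightarrow>
       s \<ge> 1 \<longrightarrow> sg \<ge> 1 \<longrightarrow> sg \<le> d \<longrightarrow> sg \<le> s \<longrightarrow> s \<le> sg * b \<longrightarrow>
       X \<in> carrier_mat n (d * b) \<longrightarrow>
       (\<exists>(lam::real) (lamg::real). lam \<ge> 0 \<and> lamg \<ge> 0 \<and> lam + lamg > 0 \<and>
          (\<forall>\<beta> \<in> carrier_vec (d * b). doubly_sparse d G (2 * s) (2 * sg) \<beta> \<longrightarrow>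
             is_arg_min (\<lambda>z. lam * l1_norm z + lamg * l12_norm d G z)
               (\<lambda>z. z \<in> carrier_vec (d * b) \<and> X *\<^sub>v z = X *\<^sub>v \<beta>) \<beta>)) \<longrightarrow>
       real n \<ge> c * (real sg * ln (real d / real sg)
                      + real s * ln (exp 1 * real sg * real b / real s)))"
proof (rule exI[of _ "1/64"], intro conjI allI impI)
  fix d b n s sg :: nat and G :: "nat \<Rightarrow> nat set" and X :: "real mat"
  assume b: "b \<ge> 3" and G: "equal_groups d b G"
    and sg: "sg \<ge> 1" "sg \<le> d" "sg \<le> s" "s \<le> sg * b" and X: "X \<in> carrier_mat n (d * b)"
    and rec: "\<exists>(lam::real) (lamg::real). lam \<ge> 0 \<and> lamg \<ge> 0 \<and> lam + lamg > 0 \<and>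
          (\<forall>\<beta> \<in> carrier_vec (d * b). doubly_sparse d G (2 * s) (2 * sg) \<beta> \<longrightarrow>
             is_arg_min (\<lambda>z. lam * l1_norm z + lamg * l12_norm d G z)
               (\<lambda>z. z \<in> carrier_vec (d * b) \<and> X *\<^sub>v z = X *\<^sub>v \<beta>) \<beta>)"
  define p where "p = d * b"
  obtain lam lamg :: real where lam: "lam \<ge> 0" "lamg \<ge> 0" "lam + lamg > 0" and
    arg_min: "\<And>\<beta>. \<beta> \<in> carrier_vec p \<Longrightarrow> doubly_sparse d G (2 * s) (2 * sg) \<beta> \<Longrightarrow>
      is_arg_min (\<lambda>z. lam * l1_norm z + lamg * l12_norm d G z)
        (\<lambda>z. z \<in> carrier_vec p \<and> X *\<^sub>v z = X *\<^sub>v \<beta>) \<beta>"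
    using rec unfolding p_def by blast
  have Gp: "k < p" if "j < d" "k \<in> G j" for j k
    using that G unfolding equal_groups_def p_def by blast
  define a where "a i k = X $$ (i, k)" for i k
  have objective: "lam * l1_norm (vec p u) + lamg * l12_norm d G (vec p u) = sg_norm p d G lam lamg u" for u
  proof -
    have "L2_set (\<lambda>i. vec p u $ i) (G j) = L2_set u (G j)" if "j < d" for j
      using Gp[OF that] by (intro L2_set_cong) auto
    then show ?thesis by (simp add: sg_norm_def l1_norm_def l12_norm_def)
  qed
  \<comment> \<open>Recovery for functions follows from minimality of \<open>vec p u\<close>: equal
    values of \<open>mat_app\<close> mean equal products with \<open>X\<close>, so
    \<open>vec p v\<close> is feasible.\<close>
  interpret sparse_group_recovery d b n s sg p G a lam lamg
  proof
    fix u v :: "nat \<Rightarrow> real"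
    assume "card {k. k < p \<and> u k \<noteq> 0} \<le> 2 * s"
      and "card {j. j < d \<and> (\<exists>i\<in>G j. u i \<noteq> 0)} \<le> 2 * sg"
      and eq: "\<forall>i<n. mat_app p a v i = mat_app p a u i"
    moreover have "{k. k < p \<and> vec p u $ k \<noteq> 0} = {k. k < p \<and> u k \<noteq> 0}" by auto
    moreover have "{j. j < d \<and> (\<exists>i\<in>G j. vec p u $ i \<noteq> 0)} = {j. j < d \<and> (\<exists>i\<in>G j. u i \<noteq> 0)}"
      using Gp by auto
    ultimately have "doubly_sparse d G (2 * s) (2 * sg) (vec p u)"
      by (simp add: doubly_sparse_def l0_def l02_def)
    then have min: "is_arg_min (\<lambda>z. lam * l1_norm z + lamg * l12_norm d G z)
        (\<lambda>z. z \<in> carrier_vec p \<and> X *\<^sub>v z = X *\<^sub>v vec p u) (vec p u)"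
      by (intro arg_min) auto
    have mv: "(X *\<^sub>v vec p w) $ i = mat_app p a w i" if "i < n" for w i
      using X that by (auto simp: mat_app_def a_def scalar_prod_def p_def atLeast0LessThan intro!: sum.cong)
    have "X *\<^sub>v vec p v = X *\<^sub>v vec p u"
      using X eq by (intro eq_vecI) (auto simp: mv simp del: index_mult_mat_vec)
    then show "sg_norm p d G lam lamg u \<le> sg_norm p d G lam lamg v"
      using min unfolding is_arg_min_def objective by (metis not_le objective vec_carrier)
  qed (use G lam p_def in auto)
  show "real n \<ge> 1/64 * (real sg * ln (real d / real sg)
                      + real s * ln (exp 1 * real sg * real b / real s))"
    using sg b by (intro sample_size_ge) auto
qed simp

end
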